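(* Let $\mathbb{K}=\mathbb{R}$ or $\mathbb{C}$. Let a positive integer $m$ and $\epsilon>0$ be given. There exists a positive integer $N$ such that, for all positive integers $n_{1},\ldots,n_{m}>N$, there exists an $m$-linear form $A_{n_{1},\ldots,n_{m}}\colon\ell_{\infty}^{n_{1}}\times\cdots\times\ell_{\infty}^{n_{m}}\to\mathbb{K}$ of the type \[ A_{n_{1},\ldots,n_{m}}(z^{(1)},\ldots,z^{(m)})=\sum_{i_{1}=1}^{n_{1}}\cdots\sum_{i_{m}=1}^{n_{m}}\pm z_{i_{1}}^{(1)}\cdots z_{i_{m}}^{(m)} \] such that \[ \Vert A_{n_{1},\ldots,n_{m}}\Vert\leq(1+\epsilon)\max\{n_{1}^{1/2},\ldots,n_{m}^{1/2}\}\prod_{j=1}^{m}n_{j}^{1/2}. \]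
   Context: $\ell_{p}^{n}$ denotes $\mathbb{K}^{n}$ with the $\ell_p$-norm. "Of the type $\sum\pm z_{i_1}^{(1)}\cdots z_{i_m}^{(m)}$" means $A(z^{(1)},\ldots,z^{(m)})=\sum_{i_1,\ldots,i_m}\varepsilon_{i_1\cdots i_m}z_{i_1}^{(1)}\cdots z_{i_m}^{(m)}$ for some choice of signs $\varepsilon_{i_1\cdots i_m}\in\{-1,1\}$. The norm of an $m$-linear form $A$ on $X_1\times\cdots\times X_m$ is $\Vert A\Vert=\sup\{|A(x^{(1)},\ldots,x^{(m)})|:\Vert x^{(k)}\Vert\le 1\}$. *)

theory Defs
  imports "HOL-Analysis.Analysis"
begin

text \<open>
  The space $\mathbb{K}^n$ with variable $n$ is represented by the functions
  \<^typ>\<open>nat \<Rightarrow> 'a\<close> that vanish outside \<^term>\<open>{1..n}\<close>. The tuples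
  $(z^{(1)}, \dots, z^{(m)})$ are the extensional functions on \<^term>\<open>{1..m}\<close>, with \<open>z k i\<close>
  standing for $z^{(k)}_i$.
\<close>

definition vecs :: "nat \<Rightarrow> (nat \<Rightarrow> 'a::zero) set" where
  "vecs n = {x. \<forall>i. i \<notin> {1..n} \<longrightarrow> x i = 0}"

definition tuples :: "nat \<Rightarrow> (nat \<Rightarrow> nat) \<Rightarrow> (nat \<Rightarrow> nat \<Rightarrow> 'a::zero) set" where
  "tuples m n = (\<Pi>\<^sub>E k\<in>{1..m}. vecs (n k))"

text \<open>The maximum is taken over a nonempty set only if \<open>n \<ge> 1\<close>.\<close>

definition linf_norm :: "nat \<Rightarrow> (nat \<Rightarrow> 'a::real_normed_field) \<Rightarrow> real" where
  "linf_norm n x = Max ((\<lambda>i. norm (x i)) ` {1..n})"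

definition multilinear_form ::
    "nat \<Rightarrow> (nat \<Rightarrow> nat) \<Rightarrow> ((nat \<Rightarrow> nat \<Rightarrow> 'a::real_normed_field) \<Rightarrow> 'a) \<Rightarrow> bool" where
  "multilinear_form m n A \<longleftrightarrow>
     (\<forall>k\<in>{1..m}. \<forall>z\<in>tuples m n. \<forall>x\<in>vecs (n k). \<forall>y\<in>vecs (n k). \<forall>a b.
        A (z(k := (\<lambda>i. a * x i + b * y i))) = a * A (z(k := x)) + b * A (z(k := y)))"

text \<open>Multi-indices $(i_1, \dots, i_m)$ are the functions \<open>i\<close> in the extensional product below.\<close>

definition sign_form ::
    "nat \<Rightarrow> (nat \<Rightarrow> nat) \<Rightarrow> ((nat \<Rightarrow> nat \<Rightarrow> 'a::real_normed_field) \<Rightarrow> 'a) \<Rightarrow> bool" where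
  "sign_form m n A \<longleftrightarrow>
     (\<exists>\<epsilon> :: (nat \<Rightarrow> nat) \<Rightarrow> 'a.
        (\<forall>i\<in>(\<Pi>\<^sub>E k\<in>{1..m}. {1..n k}). \<epsilon> i \<in> {-1, 1}) \<and>
        (\<forall>z\<in>tuples m n.
           A z = (\<Sum>i\<in>(\<Pi>\<^sub>E k\<in>{1..m}. {1..n k}). \<epsilon> i * (\<Prod>k = 1..m. z k (i k)))))"

definition form_norm ::
    "nat \<Rightarrow> (nat \<Rightarrow> nat) \<Rightarrow> ((nat \<Rightarrow> nat \<Rightarrow> 'a::real_normed_field) \<Rightarrow> 'a) \<Rightarrow> real" where
  "form_norm m n A =
     Sup {norm (A z) | z. z \<in> tuples m n \<and> (\<forall>k\<in>{1..m}. linf_norm (n k) (z k) \<le> 1)}"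

text \<open>
  \<^const>\<open>Sup\<close> on the reals is meaningful only for nonempty sets that are bounded above.
  For the forms considered here both conditions hold.
\<close>

lemma form_norm_set_nonempty:
  fixes A :: "(nat \<Rightarrow> nat \<Rightarrow> 'a::real_normed_field) \<Rightarrow> 'a"
  assumes "\<And>k. k \<in> {1..m} \<Longrightarrow> n k \<ge> 1"
  shows "{norm (A z) | z. z \<in> tuples m n \<and> (\<forall>k\<in>{1..m}. linf_norm (n k) (z k) \<le> 1)} \<noteq> {}"
proof -
  let ?z = "\<lambda>k\<in>{1..m}. (\<lambda>i::nat. 0::'a)"
  have "?z \<in> tuples m n"
    by (auto simp: tuples_def vecs_def)
  moreover have "\<forall>k\<in>{1..m}. linf_norm (n k) (?z k) \<le> 1"
    using assms by (auto simp: linf_norm_def)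
  ultimately show ?thesis by blast
qed

lemma form_norm_set_bdd_above:
  fixes A :: "(nat \<Rightarrow> nat \<Rightarrow> 'a::real_normed_field) \<Rightarrow> 'a"
  assumes "sign_form m n A"
  shows "bdd_above {norm (A z) | z. z \<in> tuples m n \<and> (\<forall>k\<in>{1..m}. linf_norm (n k) (z k) \<le> 1)}"
proof -
  let ?I = "\<Pi>\<^sub>E k\<in>{1..m}. {1..n k}"
  obtain e :: "(nat \<Rightarrow> nat) \<Rightarrow> 'a"
    where e: "\<forall>i\<in>?I. e i \<in> {-1, 1}"
      and A: "\<forall>z\<in>tuples m n. A z = (\<Sum>i\<in>?I. e i * (\<Prod>k = 1..m. z k (i k)))"
    using assms unfolding sign_form_def by blast
  have "norm (A z) \<le> real (card ?I)"
    if z: "z \<in> tuples m n" and le: "\<forall>k\<in>{1..m}. linf_norm (n k) (z k) \<le> 1" for z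
  proof -
    have "norm (e i * (\<Prod>k = 1..m. z k (i k))) \<le> 1" if i: "i \<in> ?I" for i
    proof -
      have "norm (z k (i k)) \<le> 1" if k: "k \<in> {1..m}" for k
      proof -
        have "i k \<in> {1..n k}" using i k by (auto simp: PiE_iff)
        then have "norm (z k (i k)) \<le> linf_norm (n k) (z k)"
          unfolding linf_norm_def by (intro Max_ge) auto
        then show ?thesis using le k by force
      qed
      then have "(\<Prod>k = 1..m. norm (z k (i k))) \<le> 1"
        by (intro prod_le_1) auto
      moreover have "norm (e i) = 1" using e i by auto
      ultimately show ?thesis by (simp add: norm_mult prod_norm)
    qed
    then have "norm (\<Sum>i\<in>?I. e i * (\<Prod>k = 1..m. z k (i k))) \<le> (\<Sum>i\<in>?I. 1)"
      by (intro sum_norm_le)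
    then show ?thesis using A z by simp
  qed
  then show ?thesis by (intro bdd_aboveI) auto
qed

end

theory Submission
  imports Defs "HOL-Analysis.Kronecker_Approximation_Theorem"
begin

text \<open>
  Order the dimensions increasingly, \<open>n\<^sub>1 \<le> \<dots> \<le> n\<^sub>m\<close>, and take the signs
  \<open>h\<^sub>2(i\<^sub>2, i\<^sub>1) h\<^sub>3(i\<^sub>3, i\<^sub>2) \<cdots> h\<^sub>m(i\<^sub>m, i\<^sub>m\<^sub>-\<^sub>1)\<close>, where \<open>h\<^sub>k\<close> is a corner of a Hadamard matrix of
  order between \<open>n\<^sub>k\<close> and \<open>C n\<^sub>k\<close>. Coordinatewise multiplication by a vector of the unit ball of
  \<open>\<ell>\<^sub>\<infinity>\<close> does not increase the \<open>\<ell>\<^sub>2\<close> norm, and \<open>h\<^sub>k\<close> increases its square at most by the factor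
  \<open>C n\<^sub>k\<close>. Summing over \<open>i\<^sub>1, \<dots>, i\<^sub>m\<^sub>-\<^sub>1\<close> thus leaves a vector indexed by \<open>i\<^sub>m\<close> whose squared \<open>\<ell>\<^sub>2\<close>
  norm is at most \<open>C\<^sup>m\<^sup>-\<^sup>1 n\<^sub>1 \<cdots> n\<^sub>m\<close>, and the Cauchy-Schwarz inequality gives the last factor \<open>n\<^sub>m\<close>.
  Hadamard matrices of the orders \<open>2\<^sup>a 12\<^sup>b\<close> suffice: since \<open>log 2 12\<close> is irrational, every large
  \<open>n\<close> has such a number between \<open>n\<close> and \<open>C n\<close>.
\<close>

section \<open>Numbers of the form \<open>2 ^ a * 12 ^ b\<close> between \<open>n\<close> and
  \<open>C * n\<close>\<close>

lemma power_12_neq_power_2: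
  assumes "k > 0"
  shows "(12::nat) ^ k \<noteq> 2 ^ h"
proof
  assume eq: "(12::nat) ^ k = 2 ^ h"
  have "(3::nat) dvd 12 ^ k"
    using assms by (intro dvd_trans[OF _ dvd_power[of k 12]]) auto
  then have "(3::nat) dvd 2 ^ h" using eq by simp
  then have "(3::nat) dvd 2" by (rule prime_dvd_power_nat[rotated]) simp
  then show False by simp
qed

lemma log_2_12_irrational:
  fixes k h :: int
  assumes "k > 0"
  shows "of_int k * log 2 12 \<noteq> of_int h"
proof
  assume eq: "of_int k * log 2 12 = of_int h"
  have "0 < of_int k * log 2 12" using assms by simp
  then have "h > 0" using eq by simp
  have "log 2 (12 ^ nat k) = log 2 (2 ^ nat h)"
    using eq assms \<open>h > 0\<close> by (simp add: log_nat_power)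
  then have "(12::real) ^ nat k = 2 ^ nat h"
    by (subst (asm) log_inj[THEN inj_on_eq_iff]) auto
  then have "real (12 ^ nat k) = real (2 ^ nat h)" by simp
  then have "(12::nat) ^ nat k = 2 ^ nat h" by (simp only: of_nat_eq_iff)
  then show False using power_12_neq_power_2[of "nat k" "nat h"] assms by simp
qed

text \<open>In logarithms to base 2, some \<open>a + b * \<theta>\<close> with natural
  \<open>a\<close> and \<open>b\<close> must lie between \<open>y = log 2 n\<close> and
  \<open>y + d\<close>. Dirichlet approximation supplies a step \<open>x = u + v * \<theta>\<close>
  shorter than \<open>d\<close>, positive because \<open>\<theta>\<close> is irrational. Repeated
  steps from a point just below \<open>y\<close> cannot jump over that interval.\<close>

lemma ex_order_2_12:
  fixes C :: real
  assumes "C > 1"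
  obtains N where "\<And>n. n > N \<Longrightarrow> \<exists>a b. n \<le> 2 ^ a * 12 ^ b \<and> real (2 ^ a * 12 ^ b) \<le> C * real n"
proof -
  define \<theta> where "\<theta> = log 2 (12::real)"
  define d where "d = log 2 C"
  have "\<theta> > 0" by (simp add: \<theta>_def)
  have "d > 0" using assms by (simp add: d_def)
  obtain M :: nat where M: "M > 0" "1 / real M < d"
    using \<open>d > 0\<close> by (metis nat_approx_posE of_nat_0_less_iff zero_less_Suc)
  obtain h k :: int where k: "k > 0" "\<bar>of_int k * \<theta> - of_int h\<bar> < 1 / real M"
    using Dirichlet_approx[OF M(1), of \<theta>] by metis
  define x where "x = \<bar>of_int k * \<theta> - of_int h\<bar>"
  have x: "x > 0" "x < d"
    using k M log_2_12_irrational[OF k(1), of h] by (auto simp: x_def \<theta>_def)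
  obtain u v :: int where uv: "x = of_int u + of_int v * \<theta>"
  proof (cases "of_int k * \<theta> \<ge> of_int h")
    case True
    then show ?thesis by (intro that[of "-h" k]) (auto simp: x_def)
  next
    case False
    then show ?thesis by (intro that[of h "-k"]) (auto simp: x_def)
  qed
  \<comment> \<open>At most \<open>J\<close> steps of length \<open>x\<close> are needed to cover a
    gap smaller than 1. As \<open>u\<close> or \<open>v\<close> may be negative, \<open>b0\<close>
    and the threshold \<open>Y\<close> reserve enough of both coefficients to keep them nonnegative
    during \<open>J\<close> steps.\<close>
  define J where "J = \<lceil>1 / x\<rceil>"
  define b0 where "b0 = J * \<bar>v\<bar>"
  define Y where "Y = of_int b0 * \<theta> + of_int (J * \<bar>u\<bar>)"
  show ?thesis
  proof (rule that)
    fix n :: nat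
    assume n: "n > nat \<lceil>2 powr Y\<rceil>"
    then have n0: "n > 0" by simp
    define y where "y = log 2 (real n)"
    have "2 powr Y \<le> real n" using n by linarith
    then have yY: "y \<ge> Y" using n0 by (simp add: y_def le_log_iff)
    \<comment> \<open>The starting point \<open>a0 + b0 * \<theta>\<close> misses \<open>y\<close>
      by the gap \<open>t\<close>. The least number \<open>j\<close> of steps that closes the gap
      overshoots \<open>y\<close> by less than \<open>x\<close>.\<close>
    define a0 where "a0 = \<lfloor>y - of_int b0 * \<theta>\<rfloor>"
    define t where "t = y - of_int b0 * \<theta> - of_int a0"
    have t: "0 \<le> t" "t < 1" unfolding t_def a0_def by linarith+
    have a0: "a0 \<ge> J * \<bar>u\<bar>" using yY unfolding a0_def Y_def by linarith
    define j where "j = \<lceil>t / x\<rceil>"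
    have "t / x \<ge> 0" using t x by simp
    then have j0: "j \<ge> 0" unfolding j_def by linarith
    have jJ: "j \<le> J"
      unfolding j_def J_def using t x by (intro ceiling_mono divide_right_mono) auto
    have bnd: "j * \<bar>w\<bar> \<le> J * \<bar>w\<bar>" for w :: int using jJ by (simp add: mult_right_mono)
    have jw: "- (j * \<bar>w\<bar>) \<le> j * w" for w :: int
      using j0 abs_le_D2[of "j * w" "j * \<bar>w\<bar>"] by (simp add: abs_mult)
    have a: "a0 + j * u \<ge> 0" using a0 bnd[of u] jw[of u] by linarith
    have b: "b0 + j * v \<ge> 0" using bnd[of v] jw[of v] unfolding b0_def by linarith
    define a b where "a = nat (a0 + j * u)" and "b = nat (b0 + j * v)"
    have e: "real a + real b * \<theta> = y - t + of_int j * x"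
      using a b by (simp add: a_def b_def uv t_def algebra_simps)
    have "t / x \<le> of_int j" "of_int j < t / x + 1" unfolding j_def by linarith+
    then have jx: "t \<le> of_int j * x" "of_int j * x < t + x"
      using x by (auto simp: field_simps)
    have val: "real (2 ^ a * 12 ^ b) = 2 powr (real a + real b * \<theta>)"
    proof -
      have "2 powr (real b * \<theta>) = (2 powr \<theta>) powr real b" by (simp add: powr_powr mult.commute)
      also have "\<dots> = 12 ^ b" by (simp add: \<theta>_def powr_realpow)
      finally show ?thesis by (simp add: powr_add powr_realpow)
    qed
    have "real n = 2 powr y" using n0 by (simp add: y_def)
    also have "\<dots> \<le> real (2 ^ a * 12 ^ b)" unfolding val e using jx by simp
    finally have 1: "n \<le> 2 ^ a * 12 ^ b" by (simp only: of_nat_le_iff)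
    have "real (2 ^ a * 12 ^ b) \<le> 2 powr (y + d)" unfolding val e using jx x by simp
    also have "\<dots> = C * real n" using n0 assms by (simp add: y_def d_def powr_add)
    finally show "\<exists>a b. n \<le> 2 ^ a * 12 ^ b \<and> real (2 ^ a * 12 ^ b) \<le> C * real n"
      using 1 by blast
  qed
qed

section \<open>Hadamard matrices of the orders \<open>2 ^ a * 12 ^ b\<close>\<close>

text \<open>Indices start at 0 to suit the \<open>div\<close> and \<open>mod\<close> of Kronecker
  products. Integer entries let one matrix act on real and on complex vectors.\<close>

definition hadamard :: "nat \<Rightarrow> (nat \<Rightarrow> nat \<Rightarrow> int) \<Rightarrow> bool" where
  "hadamard n h \<longleftrightarrow> (\<forall>i<n. \<forall>j<n. h i j \<in> {-1, 1}) \<and>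
     (\<forall>j<n. \<forall>k<n. j \<noteq> k \<longrightarrow> (\<Sum>i<n. h i j * h i k) = 0)"

lemma hadamard_entry: "hadamard n h \<Longrightarrow> i < n \<Longrightarrow> j < n \<Longrightarrow> h i j \<in> {-1, 1}"
  unfolding hadamard_def by blast

lemma hadamard_gram:
  assumes "hadamard n h" "j < n" "k < n"
  shows "(\<Sum>i<n. h i j * h i k) = (if j = k then int n else 0)"
proof (cases "j = k")
  case True
  have "(\<Sum>i<n. h i k * h i k) = (\<Sum>i<n. 1)"
  proof (intro sum.cong refl)
    fix i assume "i \<in> {..<n}"
    then have "h i k \<in> {-1, 1}" using hadamard_entry[OF assms(1) _ assms(3)] by simp
    then show "h i k * h i k = 1" by auto
  qed
  then show ?thesis using True by simp
qed (use assms in \<open>auto simp: hadamard_def\<close>)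

lemma hadamard_1: "hadamard 1 (\<lambda>i j. 1)"
  by (simp add: hadamard_def)

lemma hadamard_2: "hadamard 2 (\<lambda>i j. if i = 1 \<and> j = 1 then -1 else 1)"
  by (auto simp: hadamard_def less_2_cases_iff numeral_2_eq_2)

text \<open>The Paley matrix of the field with 11 elements: \<open>1, 3, 4, 5, 9\<close> are the nonzero squares
  modulo 11, and index \<open>0\<close> plays the role of the point at infinity.\<close>

definition paley_12 :: "nat \<Rightarrow> nat \<Rightarrow> int" where
  "paley_12 i j = (if i = 0 \<or> j = 0 \<or> (i + 11 - j) mod 11 \<in> {1, 3, 4, 5, 9} then 1 else -1)"

lemma hadamard_12: "hadamard 12 paley_12"
proof -
  \<comment> \<open>Tabulating the columns together with their indices turns orthogonality into a
    finite computation for the simplifier.\<close>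
  define columns :: "(nat \<times> int list) list" where
    "columns = map (\<lambda>j. (j, map (\<lambda>i. paley_12 i j) [0..<12])) [0..<12]"
  have "[0..<12] = [0, 1, 2, 3, 4, 5, 6, 7, 8, 9, 10, 11 :: nat]" by (simp add: upt_rec)
  then have "list_all (\<lambda>(j, c). list_all (\<lambda>(k, d). j = k \<or> sum_list (map2 (*) c d) = 0) columns) columns"
    unfolding columns_def by (simp only:) (simp add: paley_12_def)
  then have "(\<Sum>i<12. paley_12 i j * paley_12 i k) = 0" if "j < 12" "k < 12" "j \<noteq> k" for j k
    using that
    by (auto simp: columns_def list_all_iff zip_map_map zip_same_conv_map comp_def interv_sum_list_conv_sum_set_nat atLeast0LessThan
        simp del: upt_rec_numeral)
  then show ?thesis by (auto simp: hadamard_def paley_12_def)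
qed

lemma sum_lessThan_mult:
  fixes f :: "nat \<Rightarrow> nat \<Rightarrow> 'a::comm_monoid_add"
  shows "(\<Sum>i<a * b. f (i div b) (i mod b)) = (\<Sum>p<a. \<Sum>q<b. f p q)"
proof (cases "b = 0")
  case False
  have "(\<Sum>i<a * b. f (i div b) (i mod b)) =
      (\<Sum>p<a. \<Sum>i\<in>{p * b..<p * b + b}. f (i div b) (i mod b))"
    by (rule sum.nat_group[symmetric])
  also have "\<dots> = (\<Sum>p<a. \<Sum>q<b. f p q)"
    using False sum.shift_bounds_nat_ivl[of "\<lambda>i. f (i div b) (i mod b)" 0 "_ * b" b]
    by (simp add: add.commute lessThan_atLeast0)
  finally show ?thesis .
qed simp

text \<open>This is the Kronecker product. The scalar product of two of its columns factors into
  scalar products of columns of \<open>h\<close> and of \<open>g\<close>; distinct columns differ in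
  the quotient or the remainder of their indices, so one factor vanishes.\<close>

lemma hadamard_mult:
  assumes h: "hadamard a h" and g: "hadamard b g"
  shows "hadamard (a * b) (\<lambda>i j. h (i div b) (j div b) * g (i mod b) (j mod b))"
proof -
  have dm: "i div b < a \<and> i mod b < b" if "i < a * b" for i
    using that by (metis less_mult_imp_div_less mod_less_divisor mult_0_right not_gr_zero not_less_zero)
  show ?thesis
    unfolding hadamard_def
  proof (intro conjI allI impI)
    fix i j assume "i < a * b" "j < a * b"
    then have "h (i div b) (j div b) \<in> {-1, 1}" "g (i mod b) (j mod b) \<in> {-1, 1}"
      using dm hadamard_entry[OF h] hadamard_entry[OF g] by blast+
    then show "h (i div b) (j div b) * g (i mod b) (j mod b) \<in> {-1, 1}" by auto
  next
    fix j k assume jk: "j < a * b" "k < a * b" "j \<noteq> k"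
    have "(\<Sum>i<a * b. h (i div b) (j div b) * g (i mod b) (j mod b) *
          (h (i div b) (k div b) * g (i mod b) (k mod b))) =
        (\<Sum>p<a. \<Sum>q<b. h p (j div b) * g q (j mod b) * (h p (k div b) * g q (k mod b)))"
      by (rule sum_lessThan_mult)
    also have "\<dots> = (\<Sum>p<a. h p (j div b) * h p (k div b)) * (\<Sum>q<b. g q (j mod b) * g q (k mod b))"
      unfolding sum_product by (simp add: mult_ac)
    also have "\<dots> = 0"
    proof -
      have "j div b \<noteq> k div b \<or> j mod b \<noteq> k mod b" using jk(3) by (metis div_mult_mod_eq)
      then show ?thesis using dm[OF jk(1)] dm[OF jk(2)] by (auto simp: hadamard_gram[OF h] hadamard_gram[OF g])
    qed
    finally show "(\<Sum>i<a * b. h (i div b) (j div b) * g (i mod b) (j mod b) *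
          (h (i div b) (k div b) * g (i mod b) (k mod b))) = 0" .
  qed
qed

lemma hadamard_power:
  assumes "hadamard b g"
  shows "\<exists>h. hadamard (b ^ k) h"
proof (induction k)
  case (Suc k)
  then show ?case using hadamard_mult[OF assms] by auto
qed (use hadamard_1 in auto)

text \<open>Orthogonality of the columns makes the matrix \<open>sqrt n\<close> times an isometry:
  after expanding the squares, only the diagonal inner products survive.\<close>

lemma hadamard_sum_norm_squared:
  fixes x :: "nat \<Rightarrow> 'a::real_inner"
  assumes "hadamard n h"
  shows "(\<Sum>i<n. (norm (\<Sum>j<n. of_int (h i j) *\<^sub>R x j))\<^sup>2) = real n * (\<Sum>j<n. (norm (x j))\<^sup>2)"
proof -
  have "(\<Sum>i<n. (norm (\<Sum>j<n. of_int (h i j) *\<^sub>R x j))\<^sup>2)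
      = (\<Sum>i<n. \<Sum>j<n. \<Sum>k<n. of_int (h i j * h i k) * inner (x j) (x k))"
    by (simp add: power2_norm_eq_inner inner_sum_left inner_sum_right sum_distrib_left mult_ac inner_commute)
  also have "\<dots> = (\<Sum>j<n. \<Sum>k<n. \<Sum>i<n. of_int (h i j * h i k) * inner (x j) (x k))"
    by (subst sum.swap) (intro sum.cong refl sum.swap)
  also have "\<dots> = (\<Sum>j<n. \<Sum>k<n. of_int (\<Sum>i<n. h i j * h i k) * inner (x j) (x k))"
    by (simp add: sum_distrib_right)
  also have "\<dots> = (\<Sum>j<n. \<Sum>k<n. if j = k then real n * inner (x j) (x k) else 0)"
    using assms by (intro sum.cong refl) (simp add: hadamard_gram)
  also have "\<dots> = real n * (\<Sum>j<n. (norm (x j))\<^sup>2)"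
    by (simp add: power2_norm_eq_inner sum_distrib_left)
  finally show ?thesis .
qed

section \<open>Sign matrices of every large size\<close>

text \<open>A corner of a Hadamard matrix of order at most \<open>C * n\<close> works: using only
  \<open>l\<close> columns amounts to padding \<open>x\<close> with zeros, and omitting rows drops
  nonnegative terms.\<close>

lemma ex_sign_matrix:
  fixes C :: real
  assumes "C > 1"
  obtains N where "\<forall>n>N. \<exists>h :: nat \<Rightarrow> nat \<Rightarrow> int.
      (\<forall>i\<in>{1..n}. \<forall>j\<in>{1..n}. h i j \<in> {-1, 1}) \<and>
      (\<forall>l\<le>n. \<forall>x :: nat \<Rightarrow> 'a::real_inner.
         (\<Sum>i=1..n. (norm (\<Sum>j=1..l. of_int (h i j) *\<^sub>R x j))\<^sup>2)
           \<le> C * real n * (\<Sum>j=1..l. (norm (x j))\<^sup>2))"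
proof -
  obtain N where N: "\<And>n. n > N \<Longrightarrow> \<exists>a b. n \<le> 2 ^ a * 12 ^ b \<and> real (2 ^ a * 12 ^ b) \<le> C * real n"
    using ex_order_2_12[OF assms] by metis
  show ?thesis
  proof (intro that[of N] allI impI)
    fix n assume "n > N"
    then obtain a b where ab: "n \<le> 2 ^ a * 12 ^ b" "real (2 ^ a * 12 ^ b) \<le> C * real n"
      using N by blast
    define H where "H = (2 ^ a * 12 ^ b :: nat)"
    have "n \<le> H" "real H \<le> C * real n" using ab by (simp_all add: H_def)
    obtain g where g: "hadamard H g"
      using hadamard_power[OF hadamard_2, of a] hadamard_power[OF hadamard_12, of b] hadamard_mult
      unfolding H_def by blast
    define h where "h = (\<lambda>i j. g (i - 1) (j - 1))"
    have sgn: "h i j \<in> {-1, 1}" if "i \<in> {1..n}" "j \<in> {1..n}" for i j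
      unfolding h_def using that \<open>n \<le> H\<close> by (intro hadamard_entry[OF g]) auto
    have "(\<Sum>i=1..n. (norm (\<Sum>j=1..l. of_int (h i j) *\<^sub>R x j))\<^sup>2)
           \<le> C * real n * (\<Sum>j=1..l. (norm (x j))\<^sup>2)" if "l \<le> n" for l and x :: "nat \<Rightarrow> 'a"
    proof -
      define y where "y = (\<lambda>j. if j < l then x (Suc j) else 0)"
      \<comment> \<open>The general \<open>F\<close> serves both the matrix-vector product and the
        sum of squared norms; it removes the padding and shifts from indices starting at 0 to
        indices starting at 1.\<close>
      have low: "(\<Sum>j<H. F (y j) j) = (\<Sum>j=1..l. F (x j) (j - 1))" if "\<And>j. F 0 j = 0"
        for F :: "'a \<Rightarrow> nat \<Rightarrow> 'b::comm_monoid_add"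
      proof -
        have "(\<Sum>j<H. F (y j) j) = (\<Sum>j<l. F (x (Suc j)) j)"
          using \<open>l \<le> n\<close> \<open>n \<le> H\<close> that by (intro sum.mono_neutral_cong_right) (auto simp: y_def)
        then show ?thesis by (simp add: sum.atLeast1_atMost_eq)
      qed
      have "(\<Sum>i=1..n. (norm (\<Sum>j=1..l. of_int (h i j) *\<^sub>R x j))\<^sup>2)
          = (\<Sum>i<n. (norm (\<Sum>j<H. of_int (g i j) *\<^sub>R y j))\<^sup>2)"
        using low[of "\<lambda>v j. of_int (g i j) *\<^sub>R v" for i]
        by (simp add: h_def sum.atLeast1_atMost_eq)
      also have "\<dots> \<le> (\<Sum>i<H. (norm (\<Sum>j<H. of_int (g i j) *\<^sub>R y j))\<^sup>2)"
        using \<open>n \<le> H\<close> by (intro sum_mono2) auto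
      also have "\<dots> = real H * (\<Sum>j<H. (norm (y j))\<^sup>2)"
        by (rule hadamard_sum_norm_squared[OF g])
      also have "(\<Sum>j<H. (norm (y j))\<^sup>2) = (\<Sum>j=1..l. (norm (x j))\<^sup>2)"
        using low[of "\<lambda>v j. (norm v)\<^sup>2"] by simp
      also have "real H * \<dots> \<le> C * real n * \<dots>"
        using \<open>real H \<le> C * real n\<close> by (intro mult_right_mono sum_nonneg) auto
      finally show ?thesis .
    qed
    with sgn show "\<exists>h :: nat \<Rightarrow> nat \<Rightarrow> int.
      (\<forall>i\<in>{1..n}. \<forall>j\<in>{1..n}. h i j \<in> {-1, 1}) \<and>
      (\<forall>l\<le>n. \<forall>x :: nat \<Rightarrow> 'a.
         (\<Sum>i=1..n. (norm (\<Sum>j=1..l. of_int (h i j) *\<^sub>R x j))\<^sup>2)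
           \<le> C * real n * (\<Sum>j=1..l. (norm (x j))\<^sup>2))"
      by blast
  qed
qed

section \<open>Chaining the sign matrices along increasing dimensions\<close>

lemma sum_PiE_insert:
  assumes "l \<notin> S"
  shows "sum f (PiE (insert l S) A) = (\<Sum>j\<in>A l. \<Sum>i\<in>PiE S A. f (i(l := j)))"
  using assms
  unfolding PiE_insert_eq
  by (subst sum.reindex[OF inj_combinator]) (simp_all add: sum.cartesian_product case_prod_beta comp_def)

text \<open>The coordinate \<open>l\<close> of largest dimension stays free because the partial sums
  indexed by it form the vector on which the next matrix acts. Each coordinate added in the
  induction costs a factor \<open>C\<close> times its dimension.\<close>

lemma ex_sign_layer:
  fixes n :: "nat \<Rightarrow> nat" and C :: real
  assumes mat: "\<forall>q>N. \<exists>h :: nat \<Rightarrow> nat \<Rightarrow> int.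
      (\<forall>i\<in>{1..q}. \<forall>j\<in>{1..q}. h i j \<in> {-1, 1}) \<and>
      (\<forall>l\<le>q. \<forall>x :: nat \<Rightarrow> 'a::{real_normed_field, real_inner}.
         (\<Sum>i=1..q. (norm (\<Sum>j=1..l. of_int (h i j) *\<^sub>R x j))\<^sup>2)
           \<le> C * real q * (\<Sum>j=1..l. (norm (x j))\<^sup>2))"
    and "C > 0" "finite S" "l \<notin> S" "\<forall>k\<in>S. n k \<le> n l" "\<forall>k\<in>insert l S. n k > N"
  shows "\<exists>e :: (nat \<Rightarrow> nat) \<Rightarrow> int.
      (\<forall>i\<in>(\<Pi>\<^sub>E k\<in>insert l S. {1..n k}). e i \<in> {-1, 1}) \<and>
      (\<forall>z :: nat \<Rightarrow> nat \<Rightarrow> 'a. (\<forall>k\<in>S. \<forall>i\<in>{1..n k}. norm (z k i) \<le> 1) \<longrightarrow>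
         (\<Sum>j=1..n l. (norm (\<Sum>i\<in>(\<Pi>\<^sub>E k\<in>S. {1..n k}).
              of_int (e (i(l := j))) * (\<Prod>k\<in>S. z k (i k))))\<^sup>2)
           \<le> C ^ card S * (\<Prod>k\<in>insert l S. real (n k)))"
  using \<open>finite S\<close> \<open>l \<notin> S\<close> \<open>\<forall>k\<in>S. n k \<le> n l\<close> \<open>\<forall>k\<in>insert l S. n k > N\<close>
proof (induction "card S" arbitrary: S l)
  case 0
  \<comment> \<open>For empty \<open>S\<close> each inner sum is the single term 1, so the left side
    is \<open>n l\<close>.\<close>
  then show ?case by (intro exI[of _ "\<lambda>_. 1"]) auto
next
  case (Suc c)
  have "S \<noteq> {}" using Suc.hyps(2) by auto
  \<comment> \<open>A largest dimension \<open>n l'\<close> in \<open>S\<close> lets the induction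
    hypothesis apply with \<open>l'\<close> as the free coordinate, while
    \<open>n l' \<le> n l\<close> ensures that \<open>h\<close> has enough columns.\<close>
  then have "Max (n ` S) \<in> n ` S" using Suc.prems(1) by (intro Max_in) auto
  then obtain l' where l': "l' \<in> S" "n l' = Max (n ` S)" by auto
  define S' where "S' = S - {l'}"
  have "l \<notin> S" by (rule Suc.prems(2))
  have S: "S = insert l' S'" "l' \<notin> S'" "finite S'" "l \<noteq> l'" "l \<notin> S'"
    using l' Suc.prems unfolding S'_def by auto
  have card: "card S' = c" using S Suc.hyps(2) by simp
  have "\<forall>k\<in>S. n k \<le> n l'" unfolding l'(2) using Suc.prems(1) by simp
  then have le': "\<forall>k\<in>S'. n k \<le> n l'" by (simp add: S'_def)
  have "\<forall>k\<in>S. n k > N" using Suc.prems(4) by simp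
  then obtain e' where e': "\<forall>i\<in>(\<Pi>\<^sub>E k\<in>S. {1..n k}). e' i \<in> {-1, 1}"
    and e'_le: "\<forall>z :: nat \<Rightarrow> nat \<Rightarrow> 'a. (\<forall>k\<in>S'. \<forall>i\<in>{1..n k}. norm (z k i) \<le> 1) \<longrightarrow>
         (\<Sum>j=1..n l'. (norm (\<Sum>i\<in>(\<Pi>\<^sub>E k\<in>S'. {1..n k}).
              of_int (e' (i(l' := j))) * (\<Prod>k\<in>S'. z k (i k))))\<^sup>2)
           \<le> C ^ c * (\<Prod>k\<in>S. real (n k))"
    using Suc.hyps(1)[OF card[symmetric] S(3,2) le', folded S(1), unfolded card]
    by (elim meta_impE exE conjE) (assumption, rule that)
  have le: "n l' \<le> n l" using Suc.prems(3) l' by blast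
  have nl: "n l > N" using Suc.prems(4) by simp
  obtain h :: "nat \<Rightarrow> nat \<Rightarrow> int" where h: "\<forall>i\<in>{1..n l}. \<forall>j\<in>{1..n l}. h i j \<in> {-1, 1}"
    and h_all: "\<forall>p\<le>n l. \<forall>x :: nat \<Rightarrow> 'a. (\<Sum>i=1..n l. (norm (\<Sum>j=1..p. of_int (h i j) *\<^sub>R x j))\<^sup>2)
           \<le> C * real (n l) * (\<Sum>j=1..p. (norm (x j))\<^sup>2)"
    using mat[THEN spec, THEN mp, OF nl] by (elim exE conjE) (rule that)
  note h_le = h_all[THEN spec, THEN mp, OF le, THEN spec]
  \<comment> \<open>The new coordinate is linked to \<open>l'\<close> only. The restriction is
    needed since \<open>e'\<close> is controlled only on multi-indices that are extensional on
    \<open>S\<close>.\<close>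
  define e where "e = (\<lambda>i. e' (restrict i S) * h (i l) (i l'))"
  show ?case
  proof (intro exI[of _ e] conjI ballI allI impI)
    fix i assume i: "i \<in> (\<Pi>\<^sub>E k\<in>insert l S. {1..n k})"
    then have "restrict i S \<in> (\<Pi>\<^sub>E k\<in>S. {1..n k})" by (auto simp: PiE_iff)
    then have "e' (restrict i S) \<in> {-1, 1}" using e' by blast
    moreover have "i l \<in> {1..n l}" "i l' \<in> {1..n l'}" using i l'(1) by (auto simp: PiE_iff)
    then have "h (i l) (i l') \<in> {-1, 1}" using h le by auto
    ultimately show "e i \<in> {-1, 1}" unfolding e_def by auto
  next
    fix z :: "nat \<Rightarrow> nat \<Rightarrow> 'a"
    assume z: "\<forall>k\<in>S. \<forall>i\<in>{1..n k}. norm (z k i) \<le> 1"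
    \<comment> \<open>\<open>F\<close> is the vector left by the previous layers; the new layer
      multiplies it coordinatewise by \<open>z l'\<close> and then applies \<open>h\<close>.\<close>
    define F where "F = (\<lambda>j. \<Sum>i\<in>(\<Pi>\<^sub>E k\<in>S'. {1..n k}). of_int (e' (i(l' := j))) * (\<Prod>k\<in>S'. z k (i k)))"
    have "(\<Sum>i\<in>(\<Pi>\<^sub>E k\<in>S. {1..n k}). of_int (e (i(l := j))) * (\<Prod>k\<in>S. z k (i k)))
        = (\<Sum>j'=1..n l'. of_int (h j j') *\<^sub>R (z l' j' * F j'))" for j
    proof -
      have summand: "of_int (e (i(l' := j', l := j))) * (\<Prod>k\<in>S. z k ((i(l' := j')) k))
          = of_int (h j j') *\<^sub>R (z l' j' * (of_int (e' (i(l' := j'))) * (\<Prod>k\<in>S'. z k (i k))))"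
        if "i \<in> (\<Pi>\<^sub>E k\<in>S'. {1..n k})" for i j'
      proof -
        have "restrict (i(l' := j', l := j)) S = i(l' := j')"
          using \<open>l \<notin> S\<close> PiE_arb[OF that] by (auto simp: fun_eq_iff S(1))
        then have "e (i(l' := j', l := j)) = e' (i(l' := j')) * h j j'"
          using S(4) by (simp add: e_def)
        moreover have "(\<Prod>k\<in>S'. z k ((i(l' := j')) k)) = (\<Prod>k\<in>S'. z k (i k))"
          using S(2) by (intro prod.cong) auto
        ultimately show ?thesis
          using S(2,3) by (simp add: S(1) scaleR_conv_of_real del: fun_upd_apply) simp
      qed
      have "(\<Sum>i\<in>(\<Pi>\<^sub>E k\<in>S. {1..n k}). of_int (e (i(l := j))) * (\<Prod>k\<in>S. z k (i k)))
          = (\<Sum>j'=1..n l'. \<Sum>i\<in>(\<Pi>\<^sub>E k\<in>S'. {1..n k}).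
              of_int (e (i(l' := j', l := j))) * (\<Prod>k\<in>S. z k ((i(l' := j')) k)))"
        by (rule sum_PiE_insert[OF S(2), folded S(1)])
      also have "\<dots> = (\<Sum>j'=1..n l'. \<Sum>i\<in>(\<Pi>\<^sub>E k\<in>S'. {1..n k}). of_int (h j j') *\<^sub>R
          (z l' j' * (of_int (e' (i(l' := j'))) * (\<Prod>k\<in>S'. z k (i k)))))"
        by (intro sum.cong refl summand)
      finally show ?thesis by (simp add: F_def sum_distrib_left scaleR_sum_right)
    qed
    then have "(\<Sum>j=1..n l. (norm (\<Sum>i\<in>(\<Pi>\<^sub>E k\<in>S. {1..n k}).
              of_int (e (i(l := j))) * (\<Prod>k\<in>S. z k (i k))))\<^sup>2)
        \<le> C * real (n l) * (\<Sum>j=1..n l'. (norm (z l' j * F j))\<^sup>2)"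
      using h_le by simp
    also have "\<dots> \<le> C * real (n l) * (\<Sum>j=1..n l'. (norm (F j))\<^sup>2)"
    proof (intro mult_left_mono sum_mono power_mono)
      fix j assume "j \<in> {1..n l'}"
      then have "norm (z l' j) \<le> 1" using z l' by blast
      then show "norm (z l' j * F j) \<le> norm (F j)"
        by (simp add: norm_mult mult_left_le_one_le)
    qed (use \<open>C > 0\<close> in auto)
    also have "\<dots> \<le> C * real (n l) * (C ^ c * (\<Prod>k\<in>S. real (n k)))"
      unfolding F_def using z S(1) \<open>C > 0\<close> by (intro mult_left_mono e'_le[THEN spec, THEN mp]) auto
    also have "\<dots> = C ^ card S * (\<Prod>k\<in>insert l S. real (n k))"
      using Suc.prems(1,2) by (simp flip: Suc.hyps(2))
    finally show "(\<Sum>j=1..n l. (norm (\<Sum>i\<in>(\<Pi>\<^sub>E k\<in>S. {1..n k}).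
              of_int (e (i(l := j))) * (\<Prod>k\<in>S. z k (i k))))\<^sup>2)
        \<le> C ^ card S * (\<Prod>k\<in>insert l S. real (n k))" .
  qed
qed

section \<open>The multilinear form and its norm\<close>

lemma multilinear_form_sum:
  fixes e :: "(nat \<Rightarrow> nat) \<Rightarrow> 'a::real_normed_field"
  shows "multilinear_form m n (\<lambda>z. \<Sum>i\<in>I. e i * (\<Prod>k=1..m. z k (i k)))"
  unfolding multilinear_form_def
proof (intro ballI allI)
  fix k a b and z :: "nat \<Rightarrow> nat \<Rightarrow> 'a" and x y :: "nat \<Rightarrow> 'a"
  assume k: "k \<in> {1..m}"
  have "(\<Prod>k'=1..m. (z(k := w)) k' (i k')) = w (i k) * (\<Prod>k'\<in>{1..m} - {k}. z k' (i k'))"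
    for w :: "nat \<Rightarrow> 'a" and i
    using k by (subst prod.remove[of _ k]) auto
  then show "(\<Sum>i\<in>I. e i * (\<Prod>k'=1..m. (z(k := \<lambda>i. a * x i + b * y i)) k' (i k')))
      = a * (\<Sum>i\<in>I. e i * (\<Prod>k'=1..m. (z(k := x)) k' (i k')))
        + b * (\<Sum>i\<in>I. e i * (\<Prod>k'=1..m. (z(k := y)) k' (i k')))"
    by (simp add: algebra_simps sum.distrib sum_distrib_left)
qed

text \<open>The two type classes together cover \<open>real\<close> and \<open>complex\<close>, so a
  single argument treats both scalar fields.\<close>

lemma ex_sign_form:
  fixes m :: nat and \<epsilon> :: real
  assumes "m \<ge> 1" and "\<epsilon> > 0"
  shows "\<exists>N::nat. N \<ge> 1 \<and>
           (\<forall>n :: nat \<Rightarrow> nat. (\<forall>k\<in>{1..m}. n k > N) \<longrightarrow>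
             (\<exists>A :: (nat \<Rightarrow> nat \<Rightarrow> 'a::{real_normed_field, real_inner}) \<Rightarrow> 'a.
                multilinear_form m n A \<and> sign_form m n A \<and>
                form_norm m n A \<le>
                  (1 + \<epsilon>) * Max ((\<lambda>j. sqrt (real (n j))) ` {1..m}) * (\<Prod>j = 1..m. sqrt (real (n j)))))"
proof -
  \<comment> \<open>The \<open>m - 1\<close> layers cost \<open>C ^ (m - 1)\<close> in the squared
    norm, which is at most \<open>C ^ m = (1 + \<epsilon>)\<^sup>2\<close>. Taking the root of order
    \<open>m\<close> instead of \<open>m - 1\<close> includes the case \<open>m = 1\<close>.\<close>
  define C where "C = root m ((1 + \<epsilon>)\<^sup>2)"
  have "(1 + \<epsilon>)\<^sup>2 > 1" using assms by (simp add: one_less_power)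
  then have C: "C > 1" and C_pow: "C ^ m = (1 + \<epsilon>)\<^sup>2"
    using assms by (auto simp: C_def real_root_pow_pos2)
  then have C0: "C > 0" by simp
  obtain N0 where mat: "\<forall>q>N0. \<exists>h :: nat \<Rightarrow> nat \<Rightarrow> int.
      (\<forall>i\<in>{1..q}. \<forall>j\<in>{1..q}. h i j \<in> {-1, 1}) \<and>
      (\<forall>l\<le>q. \<forall>x :: nat \<Rightarrow> 'a.
         (\<Sum>i=1..q. (norm (\<Sum>j=1..l. of_int (h i j) *\<^sub>R x j))\<^sup>2)
           \<le> C * real q * (\<Sum>j=1..l. (norm (x j))\<^sup>2))"
    by (rule ex_sign_matrix[OF C, where 'a='a])
  show ?thesis
  proof (intro exI[of _ "Suc N0"] conjI allI impI)
    fix n :: "nat \<Rightarrow> nat"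
    assume n: "\<forall>k\<in>{1..m}. n k > Suc N0"
    have "Max (n ` {1..m}) \<in> n ` {1..m}" using assms by (intro Max_in) auto
    then obtain l where l: "l \<in> {1..m}" "n l = Max (n ` {1..m})" by auto
    define S where "S = {1..m} - {l}"
    have S: "{1..m} = insert l S" "l \<notin> S" "finite S" using l by (auto simp: S_def)
    have "Suc (card S) = m" using l by (simp add: S_def)
    have le: "\<forall>k\<in>S. n k \<le> n l" unfolding l(2) S_def by simp
    have "\<forall>k\<in>{1..m}. n k > N0" using n by auto
    then obtain e :: "(nat \<Rightarrow> nat) \<Rightarrow> int"
      where e: "\<forall>i\<in>(\<Pi>\<^sub>E k\<in>{1..m}. {1..n k}). e i \<in> {-1, 1}"
      and e_le: "\<forall>z :: nat \<Rightarrow> nat \<Rightarrow> 'a. (\<forall>k\<in>S. \<forall>i\<in>{1..n k}. norm (z k i) \<le> 1) \<longrightarrow>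
         (\<Sum>j=1..n l. (norm (\<Sum>i\<in>(\<Pi>\<^sub>E k\<in>S. {1..n k}).
              of_int (e (i(l := j))) * (\<Prod>k\<in>S. z k (i k))))\<^sup>2)
           \<le> C ^ card S * (\<Prod>k\<in>{1..m}. real (n k))"
      using ex_sign_layer[OF mat C0 S(3,2) le, folded S(1)]
      by (elim meta_impE exE conjE) (assumption, rule that)
    define A :: "(nat \<Rightarrow> nat \<Rightarrow> 'a) \<Rightarrow> 'a" where
      "A = (\<lambda>z. \<Sum>i\<in>(\<Pi>\<^sub>E k\<in>{1..m}. {1..n k}). of_int (e i) * (\<Prod>k=1..m. z k (i k)))"
    have sign: "sign_form m n A"
      unfolding sign_form_def
    proof (intro exI[of _ "\<lambda>i. of_int (e i)"] conjI ballI)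
      fix i assume "i \<in> (\<Pi>\<^sub>E k\<in>{1..m}. {1..n k})"
      then have "e i \<in> {-1, 1}" using e by blast
      then show "of_int (e i) \<in> {-1, 1::'a}" by auto
    qed (simp add: A_def)
    have bound: "norm (A z) \<le> (1 + \<epsilon>) * sqrt (real (n l)) * (\<Prod>j=1..m. sqrt (real (n j)))"
      if z: "z \<in> tuples m n" "\<forall>k\<in>{1..m}. linf_norm (n k) (z k) \<le> 1" for z
    proof (rule power2_le_imp_le)
      have z1: "norm (z k i) \<le> 1" if "k \<in> {1..m}" "i \<in> {1..n k}" for k i
      proof -
        have "norm (z k i) \<le> linf_norm (n k) (z k)"
          unfolding linf_norm_def using that by (intro Max_ge) auto
        then show ?thesis using z(2) that by force
      qed
      define F where "F = (\<lambda>j. \<Sum>i\<in>(\<Pi>\<^sub>E k\<in>S. {1..n k}). of_int (e (i(l := j))) * (\<Prod>k\<in>S. z k (i k)))"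
      have "A z = (\<Sum>j=1..n l. z l j * F j)"
      proof -
        have "(\<Prod>k\<in>S. z k ((i(l := j)) k)) = (\<Prod>k\<in>S. z k (i k))" for i j
          using S(2) by (intro prod.cong) auto
        then show ?thesis
          unfolding A_def S(1) sum_PiE_insert[OF S(2)] F_def
          using S(2,3) by (simp add: sum_distrib_left mult_ac del: fun_upd_apply) (simp add: mult_ac)
      qed
      also have "norm \<dots> \<le> (\<Sum>j=1..n l. norm (F j))"
        using z1[OF l(1)] by (intro sum_norm_le) (simp add: norm_mult mult_left_le_one_le)
      finally have "(norm (A z))\<^sup>2 \<le> (\<Sum>j=1..n l. norm (F j))\<^sup>2"
        by (intro power_mono) auto
      \<comment> \<open>Cauchy-Schwarz against the constant vector 1 costs the largest dimension
        \<open>n l\<close>, the source of the maximum in the final bound.\<close>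
      also have "\<dots> \<le> real (n l) * (\<Sum>j=1..n l. (norm (F j))\<^sup>2)"
        using sum_squared_le_sum_of_squares[of "\<lambda>j. norm (F j)" "{1..n l}"] by (simp add: mult.commute)
      also have "\<dots> \<le> real (n l) * (C ^ card S * (\<Prod>k\<in>{1..m}. real (n k)))"
        unfolding F_def using z1 by (intro mult_left_mono e_le[THEN spec, THEN mp]) (auto simp: S_def)
      also have "\<dots> \<le> real (n l) * ((1 + \<epsilon>)\<^sup>2 * (\<Prod>k\<in>{1..m}. real (n k)))"
        unfolding C_pow[symmetric] using C \<open>Suc (card S) = m\<close>
        by (intro mult_left_mono mult_right_mono power_increasing prod_nonneg) auto
      also have "\<dots> = ((1 + \<epsilon>) * sqrt (real (n l)) * (\<Prod>j=1..m. sqrt (real (n j))))\<^sup>2"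
        by (simp add: power_mult_distrib prod_power_distrib)
      finally show "(norm (A z))\<^sup>2 \<le> ((1 + \<epsilon>) * sqrt (real (n l)) * (\<Prod>j=1..m. sqrt (real (n j))))\<^sup>2" .
    qed (use assms in \<open>auto intro!: mult_nonneg_nonneg prod_nonneg\<close>)
    have "sqrt (real (n l)) \<le> Max ((\<lambda>j. sqrt (real (n j))) ` {1..m})"
      using l(1) by (intro Max_ge) auto
    then have "(1 + \<epsilon>) * sqrt (real (n l)) * (\<Prod>j=1..m. sqrt (real (n j)))
        \<le> (1 + \<epsilon>) * Max ((\<lambda>j. sqrt (real (n j))) ` {1..m}) * (\<Prod>j=1..m. sqrt (real (n j)))"
      using assms by (intro mult_right_mono mult_left_mono prod_nonneg) auto
    moreover have "form_norm m n A \<le> (1 + \<epsilon>) * sqrt (real (n l)) * (\<Prod>j=1..m. sqrt (real (n j)))"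
      unfolding form_norm_def
    proof (rule cSup_least)
      show "{norm (A z) |z. z \<in> tuples m n \<and> (\<forall>k\<in>{1..m}. linf_norm (n k) (z k) \<le> 1)} \<noteq> {}"
        using n by (intro form_norm_set_nonempty) fastforce
    qed (use bound in auto)
    ultimately show "\<exists>A :: (nat \<Rightarrow> nat \<Rightarrow> 'a) \<Rightarrow> 'a. multilinear_form m n A \<and> sign_form m n A \<and>
        form_norm m n A \<le>
          (1 + \<epsilon>) * Max ((\<lambda>j. sqrt (real (n j))) ` {1..m}) * (\<Prod>j=1..m. sqrt (real (n j)))"
      using sign multilinear_form_sum[of m n "\<lambda>i. of_int (e i)", folded A_def]
      by (intro exI[of _ A]) (auto simp: A_def multilinear_form_sum)
  qed simp
qed

theorem theorem1p1:
  fixes m :: nat and \<epsilon> :: real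
  assumes "m \<ge> 1" and "\<epsilon> > 0"
  shows "(\<exists>N::nat. N \<ge> 1 \<and>
           (\<forall>n :: nat \<Rightarrow> nat. (\<forall>k\<in>{1..m}. n k > N) \<longrightarrow>
             (\<exists>A :: (nat \<Rightarrow> nat \<Rightarrow> real) \<Rightarrow> real.
                multilinear_form m n A \<and> sign_form m n A \<and>
                form_norm m n A \<le>
                  (1 + \<epsilon>) * Max ((\<lambda>j. sqrt (real (n j))) ` {1..m}) * (\<Prod>j = 1..m. sqrt (real (n j))))))
       \<and> (\<exists>N::nat. N \<ge> 1 \<and>
           (\<forall>n :: nat \<Rightarrow> nat. (\<forall>k\<in>{1..m}. n k > N) \<longrightarrow>
             (\<exists>A :: (nat \<Rightarrow> nat \<Rightarrow> complex) \<Rightarrow> complex.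
                multilinear_form m n A \<and> sign_form m n A \<and>
                form_norm m n A \<le>
                  (1 + \<epsilon>) * Max ((\<lambda>j. sqrt (real (n j))) ` {1..m}) * (\<Prod>j = 1..m. sqrt (real (n j))))))"
  using ex_sign_form[OF assms, where 'a=real] ex_sign_form[OF assms, where 'a=complex] by blast

end
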